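(* There exists a homeomorphism $T:X\to X$ of a compact metric space $X$ with finite positive topological entropy such that the functional envelope $(H(X,X),F_T)$ has topological entropy zero. There also exists a homeomorphism $T:X\to X$ of a compact metric space $X$ with infinite topological entropy such that $(H(X,X),F_T)$ has topological entropy zero.
   Context: For a compact metric space $(X,d)$, $H(X,X)$ is the group of all self-homeomorphisms of $X$ with the uniform metric $\varrho(\varphi,\psi)=\sup_{x\in X}d(\varphi(x),\psi(x))$. For a homeomorphism $T:X\to X$, $F_T:H(X,X)\to H(X,X)$ is $F_T(\varphi)=T\circ\varphi$ (a uniformly continuous map). Topological entropy of a uniformly continuous map $S:Z\to Z$ of a (not necessarily compact) metric space $(Z,\varrho)$: for $n\ge1$ let $\varrho_n(x,y)=\max_{0\le j\le n-1}\varrho(S^jx,S^jy)$; for compact $K\subset Z$ and $\epsilon>0$ let $\mathrm{sep}(n,\epsilon;K)$ be the maximal cardinality of a set $E\subset K$ with $\varrho_n(x,y)>\epsilon$ for all distinct $x,y\in E$. Then $h_{\mathrm{top}}(S,K)=\lim_{\epsilon\to0}\limsup_{n\to\infty}\frac1n\log\mathrm{sep}(n,\epsilon;K)$ and $h_{\mathrm{top}}(S)=\sup_K h_{\mathrm{top}}(S,K)$ over all compact $K\subset Z$. *)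

theory Defs
  imports "HOL-Analysis.Analysis"
begin

text \<open>
  A metric space is a carrier \<open>Z\<close> with a distance function \<open>\<rho>\<close>, as in the locale
  \<open>Metric_space\<close>. The entropy below is meant for a uniformly continuous \<open>S\<close> mapping
  \<open>Z\<close> to itself; the values of \<open>S\<close> outside \<open>Z\<close> play no role.
\<close>

definition bowen_dist :: "('a \<Rightarrow> 'a \<Rightarrow> real) \<Rightarrow> ('a \<Rightarrow> 'a) \<Rightarrow> nat \<Rightarrow> 'a \<Rightarrow> 'a \<Rightarrow> real" where
  "bowen_dist \<rho> S n x y = Max ((\<lambda>j. \<rho> ((S ^^ j) x) ((S ^^ j) y)) ` {..<n})"

definition separated_set ::
    "('a \<Rightarrow> 'a \<Rightarrow> real) \<Rightarrow> ('a \<Rightarrow> 'a) \<Rightarrow> nat \<Rightarrow> real \<Rightarrow> 'a set \<Rightarrow> bool" where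
  "separated_set \<rho> S n \<epsilon> E \<longleftrightarrow> (\<forall>x\<in>E. \<forall>y\<in>E. x \<noteq> y \<longrightarrow> bowen_dist \<rho> S n x y > \<epsilon>)"

text \<open>
  For compact \<open>K\<close>, \<open>n \<ge> 1\<close>, \<open>\<epsilon> > 0\<close> and \<open>S\<close> continuous on \<open>Z\<close>, all separated subsets of
  \<open>K\<close> are finite, with uniformly bounded cardinality, so this maximum exists.
\<close>

definition sep :: "('a \<Rightarrow> 'a \<Rightarrow> real) \<Rightarrow> ('a \<Rightarrow> 'a) \<Rightarrow> nat \<Rightarrow> real \<Rightarrow> 'a set \<Rightarrow> nat" where
  "sep \<rho> S n \<epsilon> K = Max {card E |E. E \<subseteq> K \<and> finite E \<and> separated_set \<rho> S n \<epsilon> E}"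

text \<open>
  The limit as \<open>\<epsilon>\<close> tends to \<open>0\<close> exists in the extended reals, since \<open>sep\<close> is antitone in
  \<open>\<epsilon>\<close>. Since \<open>ln 0 = 0\<close>, the empty compact set contributes \<open>0\<close> to the supremum.
\<close>

definition htop_on :: "('a \<Rightarrow> 'a \<Rightarrow> real) \<Rightarrow> ('a \<Rightarrow> 'a) \<Rightarrow> 'a set \<Rightarrow> ereal" where
  "htop_on \<rho> S K =
     Lim (at_right (0::real)) (\<lambda>\<epsilon>. limsup (\<lambda>n. ereal (1 / real n * ln (real (sep \<rho> S n \<epsilon> K)))))"

definition htop :: "'a set \<Rightarrow> ('a \<Rightarrow> 'a \<Rightarrow> real) \<Rightarrow> ('a \<Rightarrow> 'a) \<Rightarrow> ereal" where
  "htop Z \<rho> S = (SUP K\<in>{K. compactin (Metric_space.mtopology Z \<rho>) K}. htop_on \<rho> S K)"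

definition compact_metric :: "'a set \<Rightarrow> ('a \<Rightarrow> 'a \<Rightarrow> real) \<Rightarrow> bool" where
  "compact_metric X d \<longleftrightarrow> Metric_space X d \<and> compact_space (Metric_space.mtopology X d)"

definition homeomorphism_of :: "'a set \<Rightarrow> ('a \<Rightarrow> 'a \<Rightarrow> real) \<Rightarrow> ('a \<Rightarrow> 'a) \<Rightarrow> bool" where
  "homeomorphism_of X d T \<longleftrightarrow>
     homeomorphic_map (Metric_space.mtopology X d) (Metric_space.mtopology X d) T"

text \<open>
  Self-maps of \<open>X\<close> are represented by extensional functions, so that equality means equality
  on \<open>X\<close>. For compact \<open>X\<close>, \<open>Metric_space.fdist X d X\<close> is on these homeomorphisms the uniform
  metric, i.e. the supremum of \<open>d (\<phi> x) (\<psi> x)\<close> over \<open>x \<in> X\<close>.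
\<close>

definition homeo_group :: "'a set \<Rightarrow> ('a \<Rightarrow> 'a \<Rightarrow> real) \<Rightarrow> ('a \<Rightarrow> 'a) set" where
  "homeo_group X d = {\<phi> \<in> extensional X. homeomorphism_of X d \<phi>}"

definition uniform_dist ::
    "'a set \<Rightarrow> ('a \<Rightarrow> 'a \<Rightarrow> real) \<Rightarrow> ('a \<Rightarrow> 'a) \<Rightarrow> ('a \<Rightarrow> 'a) \<Rightarrow> real" where
  "uniform_dist X d = Metric_space.fdist X d X"

definition envelope_map :: "'a set \<Rightarrow> ('a \<Rightarrow> 'a) \<Rightarrow> ('a \<Rightarrow> 'a) \<Rightarrow> ('a \<Rightarrow> 'a)" where
  "envelope_map X T \<phi> = compose X T \<phi>"

definition htop_envelope :: "'a set \<Rightarrow> ('a \<Rightarrow> 'a \<Rightarrow> real) \<Rightarrow> ('a \<Rightarrow> 'a) \<Rightarrow> ereal" where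
  "htop_envelope X d T = htop (homeo_group X d) (uniform_dist X d) (envelope_map X T)"

text \<open>
  HOL cannot quantify existentially over types, so the existence of a compact metric space is
  stated as that of a carrier \<open>X\<close> within this type with an arbitrary metric \<open>d\<close> on it. There
  is no loss of generality: a compact metric space has at most the cardinality of the
  continuum, so it is isometric to one of this form.
\<close>

type_synonym point = "nat \<Rightarrow> real"

end

theory Submission
  imports Defs
begin

text \<open>
  The space is the suspension (mapping torus) of the shift on \<open>A\<^sup>\<int>\<close> for a compact countable
  alphabet \<open>A \<subseteq> [0, 1]\<close>, with \<open>T\<close> the time-one map of the suspension flow; its entropy is \<open>ln 2\<close>
  for two letters and infinite for infinitely many.

  A homeomorphism \<open>h\<close> close to the identity maps the flow line of \<open>x\<close> to a path. After correcting
  the small, continuously varying phase shift, this path stays in a totally disconnected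
  fibre, so it is constant: \<open>h\<close> maps the flow line of \<open>x\<close> to that of \<open>h x\<close>, with a small time
  change. Since \<open>T\<close> preserves time differences along flow lines, \<open>T\<^sup>j (h x)\<close> stays close to
  \<open>h (T\<^sup>j x)\<close>, and therefore to \<open>T\<^sup>j x\<close>, for all \<open>j\<close>. With \<open>h = \<phi> \<circ> \<psi>\<^sup>-\<^sup>1\<close> this shows that the
  iterates of the envelope map are equicontinuous, so the envelope has zero entropy.
\<close>

section \<open>Entropy estimates\<close>

text \<open>\<open>sep\<close> is a \<open>Max\<close> over a set of cardinalities and has a meaning
  only if that set is finite. This predicate supplies both the finiteness and an upper
  bound.\<close>

definition bounded_separation ::
    "('a \<Rightarrow> 'a \<Rightarrow> real) \<Rightarrow> ('a \<Rightarrow> 'a) \<Rightarrow> nat \<Rightarrow> real \<Rightarrow> 'a set \<Rightarrow> nat \<Rightarrow> bool" where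
  "bounded_separation \<rho> S n \<epsilon> K N \<longleftrightarrow>
     (\<forall>E. E \<subseteq> K \<longrightarrow> finite E \<longrightarrow> separated_set \<rho> S n \<epsilon> E \<longrightarrow> card E \<le> N)"

lemma bowen_dist_gt_iff:
  "n > 0 \<Longrightarrow> bowen_dist \<rho> S n x y > \<epsilon> \<longleftrightarrow> (\<exists>j<n. \<rho> ((S ^^ j) x) ((S ^^ j) y) > \<epsilon>)"
  unfolding bowen_dist_def by (subst Max_gr_iff) auto

lemma separated_cards_finite:
  assumes "bounded_separation \<rho> S n \<epsilon> K N"
  shows "finite {card E |E. E \<subseteq> K \<and> finite E \<and> separated_set \<rho> S n \<epsilon> E}"
  using assms by (intro finite_subset[OF _ finite_atMost[of N]]) (auto simp: bounded_separation_def)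

lemma card_le_sep:
  assumes "bounded_separation \<rho> S n \<epsilon> K N" "E \<subseteq> K" "finite E" "separated_set \<rho> S n \<epsilon> E"
  shows "card E \<le> sep \<rho> S n \<epsilon> K"
  unfolding sep_def using separated_cards_finite[OF assms(1)] assms by (intro Max_ge) auto

lemma sep_le:
  assumes "bounded_separation \<rho> S n \<epsilon> K N"
  shows "sep \<rho> S n \<epsilon> K \<le> N"
proof -
  have "separated_set \<rho> S n \<epsilon> {}" by (simp add: separated_set_def)
  then have "{card E |E. E \<subseteq> K \<and> finite E \<and> separated_set \<rho> S n \<epsilon> E} \<noteq> {}"
    by (auto intro!: exI[of _ "{}"])
  then show ?thesis
    unfolding sep_def using separated_cards_finite[OF assms] assms
    by (subst Max_le_iff) (auto simp: bounded_separation_def)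
qed

lemma sep_antimono:
  assumes "bounded_separation \<rho> S n \<epsilon> K N" "\<epsilon> \<le> \<epsilon>'"
  shows "sep \<rho> S n \<epsilon>' K \<le> sep \<rho> S n \<epsilon> K"
proof (rule sep_le)
  show "bounded_separation \<rho> S n \<epsilon>' K (sep \<rho> S n \<epsilon> K)"
    unfolding bounded_separation_def
  proof (intro allI impI)
    fix E assume E: "E \<subseteq> K" "finite E" "separated_set \<rho> S n \<epsilon>' E"
    then have "separated_set \<rho> S n \<epsilon> E"
      using assms(2) by (force simp: separated_set_def)
    then show "card E \<le> sep \<rho> S n \<epsilon> K" using card_le_sep[OF assms(1)] E by blast
  qed
qed

text \<open>Pigeonhole principle: two points with the same code stay within \<epsilon> for
  \<open>n\<close> steps, so a code is injective on each separated set.\<close>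

lemma bounded_separation_by_code:
  assumes "n > 0" "finite I" "f ` K \<subseteq> I"
    and close: "\<And>x y j. \<lbrakk>x \<in> K; y \<in> K; f x = f y; j < n\<rbrakk> \<Longrightarrow> \<rho> ((S ^^ j) x) ((S ^^ j) y) \<le> \<epsilon>"
  shows "bounded_separation \<rho> S n \<epsilon> K (card I)"
  unfolding bounded_separation_def
proof (intro allI impI)
  fix E assume E: "E \<subseteq> K" "finite E" "separated_set \<rho> S n \<epsilon> E"
  have "inj_on f E"
  proof (rule inj_onI, rule ccontr)
    fix x y assume xy: "x \<in> E" "y \<in> E" "f x = f y" "x \<noteq> y"
    then obtain j where "j < n" "\<rho> ((S ^^ j) x) ((S ^^ j) y) > \<epsilon>"
      using E(3) \<open>n > 0\<close> by (auto simp: separated_set_def bowen_dist_gt_iff)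
    with close[of x y j] xy E(1) show False by (auto simp: subset_iff)
  qed
  moreover have "f ` E \<subseteq> I" using E(1) assms(3) by blast
  ultimately show "card E \<le> card I" using card_inj_on_le \<open>finite I\<close> by blast
qed

section \<open>Entropy as a supremum over scales, and criteria for its value\<close>

lemma ln_real_nat_mono: "m \<le> n \<Longrightarrow> ln (real m) \<le> ln (real n)"
  \<comment> \<open>The convention \<open>ln 0 = 0\<close> covers \<open>m = 0\<close>, since
    logarithms of positive integers are nonnegative.\<close>
  by (cases "m = 0"; cases "n = 0") auto

text \<open>The growth rate increases as \<epsilon> decreases, and a monotone limit is a supremum.
  The assumption makes every \<open>Max\<close> behind \<open>sep\<close> a genuine maximum.\<close>

lemma htop_on_eq_SUP:
  assumes "\<And>n \<epsilon>. \<lbrakk>n > 0; \<epsilon> > 0\<rbrakk> \<Longrightarrow> \<exists>N. bounded_separation \<rho> S n \<epsilon> K N"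
  shows "htop_on \<rho> S K =
    (SUP \<epsilon>\<in>{0<..}. limsup (\<lambda>n. ereal (1 / real n * ln (real (sep \<rho> S n \<epsilon> K)))))"
proof -
  define g where "g = (\<lambda>\<epsilon>. limsup (\<lambda>n. ereal (1 / real n * ln (real (sep \<rho> S n \<epsilon> K)))))"
  have anti: "g \<epsilon>' \<le> g \<epsilon>" if "0 < \<epsilon>" "\<epsilon> \<le> \<epsilon>'" for \<epsilon> \<epsilon>'
    unfolding g_def
  proof (rule Limsup_mono)
    show "\<forall>\<^sub>F n in sequentially. ereal (1 / real n * ln (real (sep \<rho> S n \<epsilon>' K)))
            \<le> ereal (1 / real n * ln (real (sep \<rho> S n \<epsilon> K)))"
      \<comment> \<open>For \<open>n = 0\<close> the Bowen distance is the \<open>Max\<close> of an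
        empty set, so only positive \<open>n\<close> are compared.\<close>
      using eventually_gt_at_top[of 0]
    proof eventually_elim
      case (elim n)
      then obtain N where "bounded_separation \<rho> S n \<epsilon> K N" using assms \<open>0 < \<epsilon>\<close> by blast
      from sep_antimono[OF this \<open>\<epsilon> \<le> \<epsilon>'\<close>] show ?case
        unfolding ereal_less_eq by (intro mult_left_mono ln_real_nat_mono) auto
    qed
  qed
  have "(g \<longlongrightarrow> (SUP \<epsilon>\<in>{0<..}. g \<epsilon>)) (at_right 0)"
  proof (rule order_tendstoI)
    fix a assume "a < (SUP \<epsilon>\<in>{0<..}. g \<epsilon>)"
    then obtain e where e: "e > 0" "a < g e" by (auto simp: less_SUP_iff)
    then show "\<forall>\<^sub>F \<epsilon> in at_right 0. a < g \<epsilon>"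
      unfolding eventually_at_right_field
      using anti by (intro exI[of _ e]) (meson less_le_trans less_imp_le)
  next
    fix a assume a: "(SUP \<epsilon>\<in>{0<..}. g \<epsilon>) < a"
    have "g \<epsilon> < a" if "\<epsilon> > 0" for \<epsilon>
      using SUP_upper[of \<epsilon> "{0<..}" g] a that by (auto intro: le_less_trans)
    then show "\<forall>\<^sub>F \<epsilon> in at_right 0. g \<epsilon> < a"
      by (auto simp: eventually_at_right_field intro: exI[of _ 1])
  qed
  then have "Lim (at_right 0) g = (SUP \<epsilon>\<in>{0<..}. g \<epsilon>)"
    by (intro tendsto_Lim) auto
  then show ?thesis by (simp add: htop_on_def g_def)
qed

text \<open>The factor \<open>C\<close> may depend on \<epsilon> but not on \<open>n\<close>; it
  contributes \<open>ln C / n\<close>, which vanishes in the limit and leaves the base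
  \<open>c\<close>.\<close>

lemma htop_on_le:
  fixes c :: real
  assumes "c \<ge> 1"
    and count: "\<And>\<epsilon>. \<epsilon> > 0 \<Longrightarrow>
      \<exists>C\<ge>1. \<forall>n>0. \<exists>N. bounded_separation \<rho> S n \<epsilon> K N \<and> real N \<le> C * c ^ n"
  shows "htop_on \<rho> S K \<le> ereal (ln c)"
proof -
  have "htop_on \<rho> S K =
    (SUP \<epsilon>\<in>{0<..}. limsup (\<lambda>n. ereal (1 / real n * ln (real (sep \<rho> S n \<epsilon> K)))))"
    using count by (intro htop_on_eq_SUP) blast
  also have "\<dots> \<le> ereal (ln c)"
  proof (rule SUP_least)
    fix \<epsilon> :: real assume "\<epsilon> \<in> {0<..}"
    then obtain C where C: "C \<ge> 1"
      and count: "\<And>n. n > 0 \<Longrightarrow> \<exists>N. bounded_separation \<rho> S n \<epsilon> K N \<and> real N \<le> C * c ^ n"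
      using count[of \<epsilon>] by auto
    have "limsup (\<lambda>n. ereal (1 / real n * ln (real (sep \<rho> S n \<epsilon> K))))
            \<le> limsup (\<lambda>n. ereal (1 / real n * ln C + ln c))"
    proof (rule Limsup_mono)
      show "\<forall>\<^sub>F n in sequentially. ereal (1 / real n * ln (real (sep \<rho> S n \<epsilon> K)))
              \<le> ereal (1 / real n * ln C + ln c)"
        using eventually_gt_at_top[of 0]
      proof eventually_elim
        case (elim n)
        then obtain N where N: "bounded_separation \<rho> S n \<epsilon> K N" "real N \<le> C * c ^ n"
          using count by blast
        have "ln (real (sep \<rho> S n \<epsilon> K)) \<le> ln (C * c ^ n)"
        proof (cases "sep \<rho> S n \<epsilon> K = 0")
          case True
          \<comment> \<open>Here the left logarithm is \<open>ln 0 = 0\<close>, so the right one has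
            to be nonnegative.\<close>
          have "1 * 1 \<le> C * c ^ n" using C \<open>c \<ge> 1\<close> by (intro mult_mono) auto
          with True show ?thesis by auto
        next
          case False
          have "real (sep \<rho> S n \<epsilon> K) \<le> C * c ^ n" using sep_le[OF N(1)] N(2) by linarith
          with False show ?thesis by simp
        qed
        also have "\<dots> = ln C + real n * ln c" using C \<open>c \<ge> 1\<close> by (simp add: ln_mult ln_realpow)
        finally have "1 / real n * ln (real (sep \<rho> S n \<epsilon> K)) \<le> 1 / real n * (ln C + real n * ln c)"
          by (intro mult_left_mono) auto
        then show ?case using elim by (simp add: field_simps)
      qed
    qed
    also have "\<dots> = ereal (ln c)"
    proof (rule lim_imp_Limsup)
      have "(\<lambda>n. 1 / real n * ln C + ln c) \<longlonglongrightarrow> 0 * ln C + ln c"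
        by (intro tendsto_intros lim_1_over_n)
      then show "(\<lambda>n. ereal (1 / real n * ln C + ln c)) \<longlonglongrightarrow> ereal (ln c)" by simp
    qed simp
    finally show "limsup (\<lambda>n. ereal (1 / real n * ln (real (sep \<rho> S n \<epsilon> K)))) \<le> ereal (ln c)" .
  qed
  finally show ?thesis .
qed

text \<open>By \<open>htop_on_eq_SUP\<close>, exponential growth at a single scale already bounds
  the entropy from below.\<close>

lemma htop_on_ge:
  assumes bounded: "\<And>n \<epsilon>. \<lbrakk>n > 0; \<epsilon> > 0\<rbrakk> \<Longrightarrow> \<exists>N. bounded_separation \<rho> S n \<epsilon> K N"
    and "\<epsilon> > 0" "k > 0"
    and large: "\<And>n. n > 0 \<Longrightarrow> \<exists>E\<subseteq>K. finite E \<and> separated_set \<rho> S n \<epsilon> E \<and> card E = k ^ n"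
  shows "ereal (ln (real k)) \<le> htop_on \<rho> S K"
proof -
  have "ereal (ln (real k)) = limsup (\<lambda>n. ereal (ln (real k)))"
    by (simp add: Limsup_const)
  also have "\<dots> \<le> limsup (\<lambda>n. ereal (1 / real n * ln (real (sep \<rho> S n \<epsilon> K))))"
  proof (rule Limsup_mono)
    show "\<forall>\<^sub>F n in sequentially. ereal (ln (real k))
            \<le> ereal (1 / real n * ln (real (sep \<rho> S n \<epsilon> K)))"
      using eventually_gt_at_top[of 0]
    proof eventually_elim
      case (elim n)
      obtain N where N: "bounded_separation \<rho> S n \<epsilon> K N" using bounded elim \<open>\<epsilon> > 0\<close> by blast
      obtain E where "E \<subseteq> K" "finite E" "separated_set \<rho> S n \<epsilon> E" "card E = k ^ n"
        using large elim by blast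
      then have "k ^ n \<le> sep \<rho> S n \<epsilon> K" using card_le_sep[OF N] by metis
      then have "ln (real (k ^ n)) \<le> ln (real (sep \<rho> S n \<epsilon> K))" by (rule ln_real_nat_mono)
      then show ?case using elim \<open>k > 0\<close> by (simp add: ln_realpow field_simps)
    qed
  qed
  also have "\<dots> \<le> htop_on \<rho> S K"
    by (subst htop_on_eq_SUP, rule bounded) (use \<open>\<epsilon> > 0\<close> in \<open>auto intro: SUP_upper\<close>)
  finally show ?thesis .
qed

lemma htop_on_nonneg:
  assumes bounded: "\<And>n \<epsilon>. \<lbrakk>n > 0; \<epsilon> > 0\<rbrakk> \<Longrightarrow> \<exists>N. bounded_separation \<rho> S n \<epsilon> K N"
  shows "0 \<le> htop_on \<rho> S K"
proof -
  have "0 \<le> ln (real m)" for m by (cases m) auto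
  then have "0 \<le> limsup (\<lambda>n. ereal (1 / real n * ln (real (sep \<rho> S n 1 K))))"
    by (intro le_Limsup always_eventually) auto
  also have "\<dots> \<le> htop_on \<rho> S K"
    by (subst htop_on_eq_SUP, rule bounded) (auto intro: SUP_upper)
  finally show ?thesis .
qed

text \<open>Equicontinuity gives a \<delta> that serves all iterates. The number of balls of radius
  \<open>\<delta>/2\<close> covering a compact set then bounds its separated sets for every
  \<open>n\<close> at once, so nothing grows.\<close>

lemma htop_equicontinuous:
  assumes Z: "Metric_space Z \<rho>"
    and equi: "\<And>\<epsilon>. \<epsilon> > 0 \<Longrightarrow> \<exists>\<delta>>0. \<forall>x\<in>Z. \<forall>y\<in>Z. \<rho> x y < \<delta> \<longrightarrow>
      (\<forall>j. \<rho> ((S ^^ j) x) ((S ^^ j) y) \<le> \<epsilon>)"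
  shows "htop Z \<rho> S = 0"
proof -
  interpret Metric_space Z \<rho> by fact
  have zero: "htop_on \<rho> S K = 0" if K: "compactin mtopology K" for K
  proof -
    have unif: "\<exists>N\<ge>1. \<forall>n>0. bounded_separation \<rho> S n \<epsilon> K N" if "\<epsilon> > 0" for \<epsilon>
    proof -
      obtain \<delta> where "\<delta> > 0"
        and \<delta>: "\<And>x y j. \<lbrakk>x \<in> Z; y \<in> Z; \<rho> x y < \<delta>\<rbrakk> \<Longrightarrow> \<rho> ((S ^^ j) x) ((S ^^ j) y) \<le> \<epsilon>"
        using equi[OF \<open>\<epsilon> > 0\<close>] by blast
      obtain F where F: "finite F" "K \<subseteq> (\<Union>x\<in>F. mball x (\<delta>/2))"
        using compactin_imp_mtotally_bounded[OF K] \<open>\<delta> > 0\<close> unfolding mtotally_bounded_def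
        by (meson half_gt_zero)
      then have "\<forall>x\<in>K. \<exists>c. c \<in> F \<and> x \<in> mball c (\<delta>/2)" by blast
      then obtain c where c: "\<And>x. x \<in> K \<Longrightarrow> c x \<in> F \<and> x \<in> mball (c x) (\<delta>/2)" by metis
      have "bounded_separation \<rho> S n \<epsilon> K (card F)" if "n > 0" for n
      proof (rule bounded_separation_by_code[OF that \<open>finite F\<close>])
        show "c ` K \<subseteq> F" using c by auto
        fix x y j assume xy: "x \<in> K" "y \<in> K" "c x = c y"
        then have "x \<in> Z" "y \<in> Z" "c x \<in> Z" "\<rho> (c x) x < \<delta>/2" "\<rho> (c x) y < \<delta>/2"
          using c[of x] c[of y] by auto
        then have "\<rho> x y < \<delta>" using triangle[of x "c x" y] commute[of x "c x"] by simp
        then show "\<rho> ((S ^^ j) x) ((S ^^ j) y) \<le> \<epsilon>" using \<delta> \<open>x \<in> Z\<close> \<open>y \<in> Z\<close> by blast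
      qed
      \<comment> \<open>\<open>F\<close> may be empty if \<open>K\<close> is, whereas
        \<open>htop_on_le\<close> asks for a factor of at least 1.\<close>
      then have "\<forall>n>0. bounded_separation \<rho> S n \<epsilon> K (max 1 (card F))"
        by (simp add: bounded_separation_def) (meson max.coboundedI2)
      then show ?thesis by (intro exI[of _ "max 1 (card F)"]) auto
    qed
    have "htop_on \<rho> S K \<le> ereal (ln 1)"
    proof (rule htop_on_le)
      fix \<epsilon> :: real assume "\<epsilon> > 0"
      from unif[OF this] obtain N where "N \<ge> 1" "\<forall>n>0. bounded_separation \<rho> S n \<epsilon> K N" by blast
      then show "\<exists>C\<ge>1. \<forall>n>0. \<exists>N. bounded_separation \<rho> S n \<epsilon> K N \<and> real N \<le> C * 1 ^ n"
        by (intro exI[of _ "real N"]) auto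
    qed simp
    moreover have "0 \<le> htop_on \<rho> S K" using unif by (intro htop_on_nonneg) blast
    ultimately show ?thesis by (simp add: zero_ereal_def)
  qed
  \<comment> \<open>A compact set has to exist for the supremum to be 0 and not
    \<open>-\<infinity>\<close>.\<close>
  have "compactin mtopology {}" by simp
  then have "(\<lambda>K. htop_on \<rho> S K) ` {K. compactin mtopology K} = {0}"
    using zero by (auto simp: image_iff intro!: exI[of _ "{}"])
  then show ?thesis by (simp add: htop_def)
qed

section \<open>The suspension of a full shift\<close>

text \<open>The bump \<open>\<bar>sin (pi * s)\<bar>\<close> vanishes at the integers, which hides
  the jumps of the floor. The absolute value gives it period 1, so a translation by an integer only
  shifts \<open>y\<close>.\<close>

definition wave :: "(int \<Rightarrow> real) \<Rightarrow> real \<Rightarrow> real" where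
  "wave y s = y \<lfloor>s\<rfloor> * \<bar>sin (pi * s)\<bar>"

text \<open>
  The coordinates of index at least 2 sample \<open>wave y\<close> at all half-integer distances from \<open>t\<close>: the
  wave vanishes at the integers, and a second sample is needed to recover \<open>y\<close> there.
\<close>

definition susp :: "real \<Rightarrow> (int \<Rightarrow> real) \<Rightarrow> point" where
  "susp t y = (\<lambda>i. case i of 0 \<Rightarrow> cos (2 * pi * t) | Suc 0 \<Rightarrow> sin (2 * pi * t)
     | Suc (Suc n) \<Rightarrow> wave y (t + of_int (int_decode n) / 2))"

text \<open>The time-one map written as a permutation of coordinates: unit time adds 2 to the
  numerator of each half-integer offset. It refers to no representation \<open>susp t y\<close>, so
  continuity and invertibility are read off coordinatewise.\<close>

definition susp_shift :: "point \<Rightarrow> point" where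
  "susp_shift x = (\<lambda>i. case i of 0 \<Rightarrow> x 0 | Suc 0 \<Rightarrow> x (Suc 0)
     | Suc (Suc n) \<Rightarrow> x (Suc (Suc (int_encode (int_decode n + 2)))))"

definition susp_unshift :: "point \<Rightarrow> point" where
  "susp_unshift x = (\<lambda>i. case i of 0 \<Rightarrow> x 0 | Suc 0 \<Rightarrow> x (Suc 0)
     | Suc (Suc n) \<Rightarrow> x (Suc (Suc (int_encode (int_decode n - 2)))))"

definition suspension :: "real set \<Rightarrow> point set" where
  "suspension A = {susp t y |t y. range y \<subseteq> A}"

lemma susp_in_suspension: "range y \<subseteq> A \<Longrightarrow> susp t y \<in> suspension A"
  by (auto simp: suspension_def)

lemma susp_simps [simp]:
  "susp t y 0 = cos (2 * pi * t)"
  "susp t y (Suc 0) = sin (2 * pi * t)"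
  "susp t y (Suc (Suc n)) = wave y (t + of_int (int_decode n) / 2)"
  by (simp_all add: susp_def)

lemma wave_add_int: "wave y (s + of_int m) = wave (\<lambda>n. y (n + m)) s"
proof -
  have "\<bar>sin (pi * (s + of_int m))\<bar> = \<bar>sin (pi * s)\<bar>"
    by (simp add: distrib_left sin_add sin_npi_int cos_npi_int abs_mult)
  then show ?thesis by (simp add: wave_def)
qed

text \<open>The gluing relation of the mapping torus: flowing for integer time is shifting the
  sequence.\<close>

lemma susp_add_int: "susp (t + of_int m) y = susp t (\<lambda>n. y (n + m))"
proof
  fix i
  have *: "2 * pi * (t + of_int m) = 2 * pi * t + 2 * pi * of_int m" by (simp add: algebra_simps)
  consider "i = 0" | "i = Suc 0" | n where "i = Suc (Suc n)" by (metis not0_implies_Suc)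
  then show "susp (t + of_int m) y i = susp t (\<lambda>n. y (n + m)) i"
  proof cases
    case 3
    have "wave y (t + of_int m + of_int (int_decode n) / 2)
            = wave y (t + of_int (int_decode n) / 2 + of_int m)" by (simp add: algebra_simps)
    with 3 show ?thesis by (simp add: wave_add_int)
  qed (simp_all add: * sin_add cos_add)
qed

lemma susp_shift_susp: "susp_shift (susp t y) = susp (t + 1) y"
proof
  fix i
  have *: "2 * pi * (t + 1) = 2 * pi * t + 2 * pi" by (simp add: algebra_simps)
  consider "i = 0" | "i = Suc 0" | n where "i = Suc (Suc n)" by (metis not0_implies_Suc)
  then show "susp_shift (susp t y) i = susp (t + 1) y i"
  proof cases
    case 3
    have "susp_shift (susp t y) i = wave y (t + (of_int (int_decode n) + 2) / 2)"
      using 3 by (simp add: susp_shift_def)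
    also have "t + (of_int (int_decode n) + 2) / 2 = t + 1 + real_of_int (int_decode n) / 2"
      by simp
    finally show ?thesis using 3 by simp
  qed (simp_all add: susp_shift_def * )
qed

lemma susp_shift_unshift [simp]: "susp_shift (susp_unshift x) = x"
  and susp_unshift_shift [simp]: "susp_unshift (susp_shift x) = x"
  by (auto simp: susp_shift_def susp_unshift_def fun_eq_iff split: nat.splits)

lemma susp_unshift_susp: "susp_unshift (susp t y) = susp (t - 1) y"
  by (metis susp_shift_susp susp_unshift_shift diff_add_cancel)

lemma susp_shift_power: "(susp_shift ^^ j) (susp t y) = susp (t + real j) y"
  by (induction j) (simp_all add: susp_shift_susp add_ac)

lemma suspension_normal_form:
  assumes "x \<in> suspension A"
  obtains t y where "x = susp t y" "0 \<le> t" "t < 1" "range y \<subseteq> A"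
proof -
  obtain t y where "x = susp t y" "range y \<subseteq> A" using assms by (auto simp: suspension_def)
  moreover have "susp t y = susp (frac t) (\<lambda>n. y (n + \<lfloor>t\<rfloor>))"
    using susp_add_int[of "frac t" "\<lfloor>t\<rfloor>" y] by (simp add: frac_def)
  ultimately show ?thesis using that[of "frac t" "\<lambda>n. y (n + \<lfloor>t\<rfloor>)"] frac_ge_0 frac_lt_1 by auto
qed

lemma susp_shift_in_suspension: "x \<in> suspension A \<Longrightarrow> susp_shift x \<in> suspension A"
  by (elim suspension_normal_form) (simp add: susp_shift_susp susp_in_suspension)

lemma susp_unshift_in_suspension: "x \<in> suspension A \<Longrightarrow> susp_unshift x \<in> suspension A"
  by (elim suspension_normal_form) (simp add: susp_unshift_susp susp_in_suspension)

section \<open>Lipschitz estimates and the product metric\<close>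

lemma abs_sin_diff_le: "\<bar>sin x - sin y\<bar> \<le> \<bar>x - y\<bar>" for x y :: real
proof -
  have "\<bar>sin x - sin y\<bar> = 2 * \<bar>sin ((x - y) / 2)\<bar> * \<bar>cos ((x + y) / 2)\<bar>"
    by (simp add: sin_diff_sin abs_mult)
  also have "\<dots> \<le> 2 * \<bar>(x - y) / 2\<bar> * 1"
    by (intro mult_mono abs_sin_x_le_abs_x) auto
  finally show ?thesis by simp
qed

lemma abs_cos_diff_le: "\<bar>cos x - cos y\<bar> \<le> \<bar>x - y\<bar>" for x y :: real
  using abs_sin_diff_le[of "pi / 2 - x" "pi / 2 - y"] by (simp add: sin_diff)

lemma wave_lipschitz:
  assumes "range y \<subseteq> {0..1}"
  shows "\<bar>wave y s - wave y t\<bar> \<le> pi * \<bar>s - t\<bar>"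
proof (induction s t rule: linorder_wlog)
  case (sym s t) then show ?case by (simp add: abs_minus_commute)
next
  case (le s t)
  have y: "0 \<le> y n" "y n \<le> 1" for n using subsetD[OF assms, of "y n"] by auto
  have sin: "\<bar>sin (pi * a) - sin (pi * b)\<bar> \<le> pi * \<bar>a - b\<bar>" for a b
    using abs_sin_diff_le[of "pi * a" "pi * b"] by (simp add: abs_mult flip: right_diff_distrib)
  show ?case
  proof (cases "\<lfloor>s\<rfloor> = \<lfloor>t\<rfloor>")
    case True
    then have "\<bar>wave y s - wave y t\<bar> = y \<lfloor>t\<rfloor> * \<bar>\<bar>sin (pi * s)\<bar> - \<bar>sin (pi * t)\<bar>\<bar>"
      using y by (simp add: wave_def abs_mult flip: right_diff_distrib)
    also have "\<dots> \<le> 1 * (pi * \<bar>s - t\<bar>)"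
      using sin[of s t] y by (intro mult_mono) auto
    finally show ?thesis by simp
  next
    case False
    \<comment> \<open>An integer between \<open>s\<close> and \<open>t\<close>. The wave vanishes
      there, so both values are compared with 0, and the two distances to \<open>m\<close> add up to
      the distance of \<open>s\<close> and \<open>t\<close>.\<close>
    define m where "m = \<lfloor>t\<rfloor>"
    have m: "s < of_int m" "of_int m \<le> t"
      using False le floor_mono[OF le] unfolding m_def by linarith+
    have bound: "\<bar>wave y r\<bar> \<le> pi * \<bar>r - of_int m\<bar>" for r
    proof -
      have "\<bar>wave y r\<bar> \<le> 1 * \<bar>sin (pi * r)\<bar>"
        unfolding wave_def abs_mult using y by (intro mult_mono) auto
      also have "sin (pi * r) = sin (pi * r) - sin (pi * of_int m)"
        by (simp add: sin_npi_int)
      finally show ?thesis using sin[of r "of_int m"] by simp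
    qed
    have "\<bar>wave y s - wave y t\<bar> \<le> pi * \<bar>s - of_int m\<bar> + pi * \<bar>t - of_int m\<bar>"
      using bound[of s] bound[of t] by linarith
    also have "\<dots> = pi * \<bar>s - t\<bar>" using m by (simp flip: distrib_left)
    finally show ?thesis .
  qed
qed

text \<open>Triangle inequality through \<open>susp t' y\<close>: changing the time is a Lipschitz
  step, and changing the sequence at the fixed time \<open>t'\<close> affects a sample through one
  letter only. For \<open>i < 2\<close> the truncated \<open>i - 2\<close> yields some index, whose
  term merely enlarges the bound.\<close>

lemma susp_coord_diff:
  fixes t t' :: real
  assumes "range y \<subseteq> {0..1}"
  defines "l \<equiv> \<lambda>i. \<lfloor>t' + of_int (int_decode (i - 2)) / 2\<rfloor>"
  shows "\<bar>susp t y i - susp t' y' i\<bar> \<le> 2 * pi * \<bar>t - t'\<bar> + \<bar>y (l i) - y' (l i)\<bar>"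
proof -
  have t: "\<bar>2 * pi * t - 2 * pi * t'\<bar> = 2 * pi * \<bar>t - t'\<bar>"
    by (simp add: abs_mult flip: right_diff_distrib)
  consider "i = 0" | "i = Suc 0" | n where "i = Suc (Suc n)" by (metis not0_implies_Suc)
  then show ?thesis
  proof cases
    case 1
    then show ?thesis using abs_cos_diff_le[of "2 * pi * t" "2 * pi * t'"] t by simp
  next
    case 2
    then show ?thesis using abs_sin_diff_le[of "2 * pi * t" "2 * pi * t'"] t by simp
  next
    case 3
    define c where "c = real_of_int (int_decode n) / 2"
    have l: "l i = \<lfloor>t' + c\<rfloor>" using 3 by (simp add: l_def c_def)
    have "wave y (t' + c) - wave y' (t' + c) = (y (l i) - y' (l i)) * \<bar>sin (pi * (t' + c))\<bar>"
      by (simp add: wave_def l algebra_simps)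
    then have "\<bar>wave y (t' + c) - wave y' (t' + c)\<bar> \<le> \<bar>y (l i) - y' (l i)\<bar> * 1"
      by (simp only: abs_mult abs_abs) (intro mult_left_mono, auto)
    moreover have "\<bar>wave y (t + c) - wave y (t' + c)\<bar> \<le> pi * \<bar>t - t'\<bar>"
      using wave_lipschitz[OF assms(1), of "t + c" "t' + c"] by simp
    moreover have "pi * \<bar>t - t'\<bar> \<ge> 0" by simp
    ultimately show ?thesis using 3 by (simp add: c_def)
  qed
qed

lemma dist_point_le:
  assumes "\<epsilon> > 0"
  obtains F \<eta> where "finite F" "\<eta> > 0"
    "\<And>x y :: point. (\<And>i. i \<in> F \<Longrightarrow> \<bar>x i - y i\<bar> \<le> \<eta>) \<Longrightarrow> dist x y \<le> \<epsilon>"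
proof -
  obtain N where N: "(1/2::real) ^ N < \<epsilon> / 2"
    using real_arch_pow_inv[of "\<epsilon> / 2" "1/2"] assms by auto
  \<comment> \<open>The leading coordinates enter the library bound with factor 2 and the tail with
    \<open>(1/2) ^ N\<close>, which gives 2 * \<epsilon>/4 + \<epsilon>/2.\<close>
  show ?thesis
  proof (rule that[of "from_nat ` {..N}" "\<epsilon> / 4"])
    fix x y :: point assume *: "\<And>i. i \<in> from_nat ` {..N} \<Longrightarrow> \<bar>x i - y i\<bar> \<le> \<epsilon> / 4"
    have eq: "{dist (x (from_nat n)) (y (from_nat n)) |n. n \<le> N}
      = (\<lambda>n. dist (x (from_nat n)) (y (from_nat n))) ` {..N}" by auto
    have "Max {dist (x (from_nat n)) (y (from_nat n)) |n. n \<le> N} \<le> \<epsilon> / 4"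
      unfolding eq using * by (subst Max_le_iff) (auto simp: dist_real_def)
    then show "dist x y \<le> \<epsilon>" using dist_fun_le_dist_first_terms[of x y N] N by linarith
  qed (use assms in auto)
qed

text \<open>The distance is a series of nonnegative terms, and the single term of the coordinate
  \<open>i\<close> is a lower bound for it.\<close>

lemma dist_point_coord:
  assumes "\<epsilon> > 0"
  obtains \<delta> where "\<delta> > 0" "\<And>x y :: point. dist x y < \<delta> \<Longrightarrow> \<bar>x i - y i\<bar> < \<epsilon>"
proof
  define n where "n = to_nat i"
  show "(1/2) ^ n * min \<epsilon> 1 > 0" using assms by simp
  fix x y :: point assume d: "dist x y < (1/2) ^ n * min \<epsilon> 1"
  have "summable (\<lambda>n. (1/2) ^ n * min (dist (x (from_nat n)) (y (from_nat n))) 1)"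
    by (rule summable_comparison_test'[of "\<lambda>n. (1/2)^n"]) (auto simp: summable_geometric_iff)
  from sum_le_suminf[OF this, of "{n}"]
  have "(1/2) ^ n * min (dist (x i) (y i)) 1 \<le> dist x y"
    by (simp add: dist_fun_def n_def)
  with d have "(1/2) ^ n * min (dist (x i) (y i)) 1 < (1/2) ^ n * min \<epsilon> 1" by linarith
  then have "min (dist (x i) (y i)) 1 < min \<epsilon> 1" by (simp only: mult_less_cancel_left_pos zero_less_power half_gt_zero_iff zero_less_one)
  then show "\<bar>x i - y i\<bar> < \<epsilon>" by (auto simp: dist_real_def min_def split: if_splits)
qed

text \<open>For equal sequences only the time term of \<open>susp_coord_diff\<close> remains. It
  depends neither on the coordinate nor on \<open>y\<close>, so one \<open>r\<close> serves all flow
  lines.\<close>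

lemma susp_time_uniform:
  assumes "\<epsilon> > 0"
  obtains r where "r > 0"
    "\<And>y t t'. \<lbrakk>range y \<subseteq> {0..1}; \<bar>t - t'\<bar> \<le> r\<rbrakk> \<Longrightarrow> dist (susp t y) (susp t' y) \<le> \<epsilon>"
proof -
  obtain F \<eta> where F: "\<eta> > 0" "\<And>x y :: point. (\<And>i. i \<in> F \<Longrightarrow> \<bar>x i - y i\<bar> \<le> \<eta>) \<Longrightarrow> dist x y \<le> \<epsilon>"
    using dist_point_le[OF assms] by metis
  show ?thesis
  proof (rule that[of "\<eta> / (2 * pi)"])
    fix t t' :: real and y :: "int \<Rightarrow> real" assume y: "range y \<subseteq> {0..1::real}" and t: "\<bar>t - t'\<bar> \<le> \<eta> / (2 * pi)"
    show "dist (susp t y) (susp t' y) \<le> \<epsilon>"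
    proof (rule F(2))
      fix i
      have "2 * pi * \<bar>t - t'\<bar> \<le> \<eta>" using t by (simp add: field_simps)
      then show "\<bar>susp t y i - susp t' y i\<bar> \<le> \<eta>"
        using susp_coord_diff[OF y, of t i t' y] by simp
    qed
  qed (use \<open>\<eta> > 0\<close> in simp)
qed

section \<open>Compactness of the suspension and continuity of its shift\<close>

lemma continuous_on_susp:
  "continuous_on (UNIV \<times> {y :: int \<Rightarrow> real. range y \<subseteq> {0..1}}) (\<lambda>p. susp (fst p) (snd p))"
proof (rule continuous_on_coordinatewise_then_product)
  fix i
  let ?S = "(UNIV :: real set) \<times> {y :: int \<Rightarrow> real. range y \<subseteq> {0..1::real}}"
  show "continuous_on ?S (\<lambda>p. susp (fst p) (snd p) i)"
    unfolding continuous_on_def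
  proof
    fix p assume "p \<in> ?S"
    \<comment> \<open>The floor is taken at the base point \<open>p\<close>, so the letter that is
      compared stays the same while \<open>q\<close> moves.\<close>
    define l where "l = \<lfloor>fst p + of_int (int_decode (i - 2)) / 2\<rfloor>"
    have ev: "continuous_on UNIV (\<lambda>q :: real \<times> (int \<Rightarrow> real). snd q l)"
      by (rule continuous_on_product_then_coordinatewise) (rule continuous_on_snd, rule continuous_on_id)
    have "((\<lambda>q. 2 * pi * \<bar>fst q - fst p\<bar> + \<bar>snd q l - snd p l\<bar>)
        \<longlongrightarrow> 2 * pi * \<bar>fst p - fst p\<bar> + \<bar>snd p l - snd p l\<bar>) (at p within ?S)"
    proof (intro tendsto_intros)
      show "((\<lambda>q. snd q l) \<longlongrightarrow> snd p l) (at p within ?S)"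
        using ev tendsto_within_subset[OF _ subset_UNIV] unfolding continuous_on_def by blast
    qed
    then have lim: "((\<lambda>q. 2 * pi * \<bar>fst q - fst p\<bar> + \<bar>snd q l - snd p l\<bar>) \<longlongrightarrow> 0) (at p within ?S)"
      by simp
    have "((\<lambda>q. susp (fst q) (snd q) i - susp (fst p) (snd p) i) \<longlongrightarrow> 0) (at p within ?S)"
    proof (rule Lim_null_comparison[OF _ lim])
      show "\<forall>\<^sub>F q in at p within ?S. norm (susp (fst q) (snd q) i - susp (fst p) (snd p) i)
              \<le> 2 * pi * \<bar>fst q - fst p\<bar> + \<bar>snd q l - snd p l\<bar>"
        unfolding eventually_at_filter l_def real_norm_def
        by (rule always_eventually) (auto intro!: susp_coord_diff)
    qed
    then show "((\<lambda>q. susp (fst q) (snd q) i) \<longlongrightarrow> susp (fst p) (snd p) i) (at p within ?S)"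
      using Lim_null by blast
  qed
qed

text \<open>A continuous image of the product of the unit interval and the sequence space, which is
  compact by Tychonoff's theorem.\<close>

lemma compact_suspension:
  assumes "compact A" "A \<subseteq> {0..1}"
  shows "compact (suspension A)"
proof -
  have "compactin (product_topology (\<lambda>_. euclidean) UNIV) (\<Pi>\<^sub>E n\<in>(UNIV :: int set). A)"
    using \<open>compact A\<close> by (simp add: compactin_PiE)
  moreover have "(\<Pi>\<^sub>E n\<in>(UNIV :: int set). A) = {y. range y \<subseteq> A}" by (auto simp: PiE_def Pi_def)
  ultimately have "compact {y :: int \<Rightarrow> real. range y \<subseteq> A}"
    by (simp add: euclidean_product_topology)
  then have "compact ({0..1::real} \<times> {y :: int \<Rightarrow> real. range y \<subseteq> A})"
    by (intro compact_Times) auto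
  moreover have "continuous_on ({0..1} \<times> {y. range y \<subseteq> A}) (\<lambda>p. susp (fst p) (snd p))"
    by (rule continuous_on_subset[OF continuous_on_susp]) (use \<open>A \<subseteq> {0..1}\<close> in auto)
  ultimately have "compact ((\<lambda>p. susp (fst p) (snd p)) ` ({0..1} \<times> {y. range y \<subseteq> A}))"
    by (rule compact_continuous_image[rotated])
  also have "(\<lambda>p. susp (fst p) (snd p)) ` ({0..1} \<times> {y. range y \<subseteq> A}) = suspension A"
  proof (intro equalityI subsetI)
    fix x assume "x \<in> suspension A"
    then obtain t y where "x = susp t y" "0 \<le> t" "t < 1" "range y \<subseteq> A"
      by (rule suspension_normal_form)
    then show "x \<in> (\<lambda>p. susp (fst p) (snd p)) ` ({0..1} \<times> {y. range y \<subseteq> A})"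
      by (intro image_eqI[of _ _ "(t, y)"]) auto
  qed (auto intro: susp_in_suspension)
  finally show ?thesis .
qed

lemma Metric_space_subset: "Metric_space X (dist :: 'a::metric_space \<Rightarrow> 'a \<Rightarrow> real)"
  using Metric_space.subspace[OF Met_TC.Metric_space_axioms] by blast

text \<open>Translates the carrier-based notions of the definitions into subspaces of the type-class
  topology.\<close>

lemma mtopology_subset:
  "Metric_space.mtopology X (dist :: 'a::metric_space \<Rightarrow> 'a \<Rightarrow> real) = top_of_set X"
proof -
  interpret Submetric UNIV dist X by unfold_locales auto
  show ?thesis using mtopology_submetric by simp
qed

lemma compact_metric_suspension:
  assumes "compact A" "A \<subseteq> {0..1}"
  shows "compact_metric (suspension A) dist"
  using compact_suspension[OF assms]
  by (simp add: compact_metric_def Metric_space_subset mtopology_subset compact_space_subtopology)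

lemma continuous_on_susp_shift: "continuous_on S susp_shift"
  and continuous_on_susp_unshift: "continuous_on S susp_unshift"
proof -
  have "continuous_on UNIV (\<lambda>x. susp_shift x i) \<and> continuous_on UNIV (\<lambda>x. susp_unshift x i)" for i
  proof (cases i)
    case (Suc n)
    then show ?thesis by (cases n) (simp_all add: susp_shift_def susp_unshift_def)
  qed (simp_all add: susp_shift_def susp_unshift_def)
  then have "continuous_on UNIV susp_shift" "continuous_on UNIV susp_unshift"
    by (auto intro: continuous_on_coordinatewise_then_product)
  then show "continuous_on S susp_shift" "continuous_on S susp_unshift"
    by (auto intro: continuous_on_subset)
qed

lemma homeomorphism_susp_shift: "homeomorphism_of (suspension A) dist susp_shift"
  unfolding homeomorphism_of_def mtopology_subset homeomorphic_map_maps
  by (rule exI[of _ susp_unshift])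
    (auto simp: homeomorphic_maps_def continuous_on_susp_shift continuous_on_susp_unshift
      susp_shift_in_suspension susp_unshift_in_suspension)

section \<open>Entropy of the suspension\<close>

lemma abs_diff_le_of_floor_eq:
  fixes x y c :: real
  assumes "\<lfloor>c * x\<rfloor> = \<lfloor>c * y\<rfloor>" "c > 0"
  shows "\<bar>x - y\<bar> \<le> 1 / c"
proof -
  have "\<bar>c * x - c * y\<bar> \<le> 1" using assms(1) by linarith
  then have "c * \<bar>x - y\<bar> \<le> 1" using \<open>c > 0\<close> by (simp add: abs_mult flip: right_diff_distrib)
  then show ?thesis using \<open>c > 0\<close> by (simp add: field_simps)
qed

text \<open>Time and letters are rounded to multiples of \<open>1/M\<close>, and \<open>n\<close>
  iterates see only a window of letters of length \<open>n\<close> plus a constant. Counting rounded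
  letters serves both alphabets: there are finitely many of them even if \<open>A\<close> is
  infinite, and at most \<open>card A\<close> if it is finite.\<close>

lemma bounded_separation_suspension:
  assumes "A \<subseteq> {0..1}" "\<epsilon> > 0"
  obtains M m where "M > 0"
    "\<And>n K. \<lbrakk>n > 0; K \<subseteq> suspension A\<rbrakk> \<Longrightarrow>
       bounded_separation dist susp_shift n \<epsilon> K (M * card ((\<lambda>a. \<lfloor>real M * a\<rfloor>) ` A) ^ (n + 2 * m + 1))"
proof -
  obtain F \<eta> where F: "finite F" "\<eta> > 0"
    "\<And>x y :: point. (\<And>i. i \<in> F \<Longrightarrow> \<bar>x i - y i\<bar> \<le> \<eta>) \<Longrightarrow> dist x y \<le> \<epsilon>"
    using dist_point_le[OF \<open>\<epsilon> > 0\<close>] by metis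
  \<comment> \<open>The mesh at which the bound \<open>2 * pi / M + 1 / M\<close> from
    \<open>susp_coord_diff\<close> is at most \<eta>.\<close>
  obtain M :: nat where M: "M > 0" "(2 * pi + 1) / \<eta> \<le> real M"
    by (metis order.trans nless_le of_nat_le_iff real_arch_simple zero_less_Suc le_SucI not_gr_zero
        less_imp_le)
  \<comment> \<open>The finitely many coordinates in \<open>F\<close> look at most
    \<open>m / 2\<close> away from the current time.\<close>
  obtain m where m: "\<And>i. i \<in> F \<Longrightarrow> \<bar>int_decode (i - 2)\<bar> \<le> int m"
  proof
    fix i assume "i \<in> F"
    then have "nat \<bar>int_decode (i - 2)\<bar> \<le> Max ((\<lambda>i. nat \<bar>int_decode (i - 2)\<bar>) ` F)"
      using \<open>finite F\<close> by simp
    then show "\<bar>int_decode (i - 2)\<bar> \<le> int (Max ((\<lambda>i. nat \<bar>int_decode (i - 2)\<bar>) ` F))"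
      by linarith
  qed
  let ?R = "(\<lambda>a. \<lfloor>real M * a\<rfloor>) ` A"
  have "?R \<subseteq> {0..int M}"
  proof
    fix k assume "k \<in> ?R"
    then obtain a where a: "a \<in> A" "k = \<lfloor>real M * a\<rfloor>" by blast
    then have "0 \<le> a" "a \<le> 1" using assms by auto
    then have "0 \<le> real M * a" "real M * a \<le> real M * 1"
      by (auto intro!: mult_left_mono simp del: mult_1_right)
    then have "0 \<le> k" "k \<le> int M" unfolding a(2) by linarith+
    then show "k \<in> {0..int M}" by simp
  qed
  then have "finite ?R" using finite_subset by blast
  have "\<forall>x\<in>suspension A. \<exists>t y. x = susp t y \<and> 0 \<le> t \<and> t < 1 \<and> range y \<subseteq> A"
    by (meson suspension_normal_form)
  then obtain \<tau> \<omega> where nf: "\<And>x. x \<in> suspension A \<Longrightarrow>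
      x = susp (\<tau> x) (\<omega> x) \<and> 0 \<le> \<tau> x \<and> \<tau> x < 1 \<and> range (\<omega> x) \<subseteq> A" by metis
  show ?thesis
  proof (rule that[OF \<open>M > 0\<close>])
    fix n :: nat and K assume "n > 0" and K: "K \<subseteq> suspension A"
    \<comment> \<open>All letters that the coordinates in \<open>F\<close> can meet at times between
      0 and \<open>n\<close>.\<close>
    define W where "W = {- int m..int n + int m}"
    define code where "code = (\<lambda>x. (\<lfloor>real M * \<tau> x\<rfloor>, restrict (\<lambda>l. \<lfloor>real M * \<omega> x l\<rfloor>) W))"
    define I where "I = {0..<int M} \<times> (\<Pi>\<^sub>E l\<in>W. ?R)"
    have "finite W" "card W = n + 2 * m + 1" by (auto simp: W_def)
    then have card: "card I = M * card ?R ^ (n + 2 * m + 1)"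
      by (simp add: I_def card_cartesian_product card_PiE)
    have "bounded_separation dist susp_shift n \<epsilon> K (card I)"
    proof (rule bounded_separation_by_code[OF \<open>n > 0\<close>])
      show "finite I" using \<open>finite ?R\<close> \<open>finite W\<close> by (auto simp: I_def intro!: finite_PiE)
      show "code ` K \<subseteq> I"
      proof
        fix u assume "u \<in> code ` K"
        then obtain x where x: "x \<in> K" "u = code x" by blast
        then have "0 \<le> \<tau> x" "\<tau> x < 1" "range (\<omega> x) \<subseteq> A" using nf K by blast+
        moreover have "real M * \<tau> x < real M * 1"
          using \<open>\<tau> x < 1\<close> \<open>M > 0\<close> by (intro mult_strict_left_mono) auto
        moreover have "0 \<le> real M * \<tau> x" using \<open>0 \<le> \<tau> x\<close> by simp
        ultimately show "u \<in> I"
          by (auto simp: x(2) code_def I_def floor_less_iff)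
      qed
      fix x y j assume xy: "x \<in> K" "y \<in> K" "code x = code y" and "j < n"
      have x: "x = susp (\<tau> x) (\<omega> x)" "range (\<omega> x) \<subseteq> {0..1}"
        and y: "y = susp (\<tau> y) (\<omega> y)" "0 \<le> \<tau> y" "\<tau> y < 1"
        using nf[of x] nf[of y] xy K assms by auto
      have \<tau>: "\<bar>\<tau> x - \<tau> y\<bar> \<le> 1 / M"
        using xy(3) \<open>M > 0\<close> by (intro abs_diff_le_of_floor_eq) (auto simp: code_def)
      have \<omega>: "\<bar>\<omega> x l - \<omega> y l\<bar> \<le> 1 / M" if "l \<in> W" for l
      proof (rule abs_diff_le_of_floor_eq)
        have "restrict (\<lambda>l. \<lfloor>real M * \<omega> x l\<rfloor>) W l = restrict (\<lambda>l. \<lfloor>real M * \<omega> y l\<rfloor>) W l"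
          using xy(3) by (simp add: code_def)
        then show "\<lfloor>real M * \<omega> x l\<rfloor> = \<lfloor>real M * \<omega> y l\<rfloor>" using that by simp
      qed (use \<open>M > 0\<close> in simp)
      have "dist (susp (\<tau> x + real j) (\<omega> x)) (susp (\<tau> y + real j) (\<omega> y)) \<le> \<epsilon>"
      proof (rule F(3))
        fix i assume "i \<in> F"
        define l where "l = \<lfloor>\<tau> y + real j + of_int (int_decode (i - 2)) / 2\<rfloor>"
        have "\<bar>real_of_int (int_decode (i - 2))\<bar> \<le> real m" using m[OF \<open>i \<in> F\<close>] by linarith
        moreover have "real j \<le> real n - 1" using \<open>j < n\<close> by linarith
        ultimately have "l \<in> W" using y(2,3) unfolding l_def W_def atLeastAtMost_iff by linarith
        have "\<bar>susp (\<tau> x + real j) (\<omega> x) i - susp (\<tau> y + real j) (\<omega> y) i\<bar>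
            \<le> 2 * pi * \<bar>(\<tau> x + real j) - (\<tau> y + real j)\<bar> + \<bar>\<omega> x l - \<omega> y l\<bar>"
          unfolding l_def by (rule susp_coord_diff[OF x(2)])
        also have "\<dots> \<le> 2 * pi * (1 / M) + 1 / M"
          using \<tau> \<omega>[OF \<open>l \<in> W\<close>] by (intro add_mono mult_left_mono) auto
        also have "\<dots> = (2 * pi + 1) / M" by (simp add: add_divide_distrib)
        also have "\<dots> \<le> \<eta>" using M \<open>\<eta> > 0\<close> by (simp add: field_simps)
        finally show "\<bar>susp (\<tau> x + real j) (\<omega> x) i - susp (\<tau> y + real j) (\<omega> y) i\<bar> \<le> \<eta>" .
      qed
      then show "dist ((susp_shift ^^ j) x) ((susp_shift ^^ j) y) \<le> \<epsilon>"
        by (metis susp_shift_power x(1) y(1))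
    qed
    then show "bounded_separation dist susp_shift n \<epsilon> K (M * card ?R ^ (n + 2 * m + 1))"
      unfolding card .
  qed
qed

text \<open>Rounding can only merge letters, so the codes number at most a constant times
  \<open>card A ^ n\<close>; the mesh and the \<open>2 * m + 1\<close> extra letters go into the
  constant.\<close>

lemma htop_suspension_le:
  assumes "A \<subseteq> {0..1}" "finite A" "A \<noteq> {}"
  shows "htop (suspension A) dist susp_shift \<le> ereal (ln (real (card A)))"
  unfolding htop_def mtopology_subset
proof (rule SUP_least)
  fix K assume "K \<in> {K. compactin (top_of_set (suspension A)) K}"
  then have K: "K \<subseteq> suspension A" using compactin_subset_topspace by fastforce
  have "card A \<ge> 1" using assms by (simp add: Suc_le_eq card_gt_0_iff)
  show "htop_on dist susp_shift K \<le> ereal (ln (real (card A)))"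
  proof (rule htop_on_le)
    fix \<epsilon> :: real assume "\<epsilon> > 0"
    obtain M m where M: "M > 0" "\<And>n K. \<lbrakk>n > 0; K \<subseteq> suspension A\<rbrakk> \<Longrightarrow>
       bounded_separation dist susp_shift n \<epsilon> K (M * card ((\<lambda>a. \<lfloor>real M * a\<rfloor>) ` A) ^ (n + 2 * m + 1))"
      using bounded_separation_suspension[OF assms(1) \<open>\<epsilon> > 0\<close>] by metis
    show "\<exists>C\<ge>1. \<forall>n>0. \<exists>N. bounded_separation dist susp_shift n \<epsilon> K N
        \<and> real N \<le> C * real (card A) ^ n"
    proof (intro exI[of _ "real (M * card A ^ (2 * m + 1))"] conjI allI impI)
      have "1 \<le> M * card A ^ (2 * m + 1)" using \<open>M > 0\<close> \<open>card A \<ge> 1\<close> by (simp add: Suc_le_eq)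
      then show "1 \<le> real (M * card A ^ (2 * m + 1))" by (metis of_nat_1 of_nat_le_iff)
      fix n :: nat assume "n > 0"
      let ?N = "M * card ((\<lambda>a. \<lfloor>real M * a\<rfloor>) ` A) ^ (n + 2 * m + 1)"
      have "?N \<le> M * card A ^ (n + 2 * m + 1)"
        using card_image_le[OF \<open>finite A\<close>] by (intro mult_left_mono power_mono) auto
      also have "\<dots> = M * card A ^ (2 * m + 1) * card A ^ n" by (simp add: power_add)
      finally have "real ?N \<le> real (M * card A ^ (2 * m + 1) * card A ^ n)" by (rule of_nat_mono)
      then show "\<exists>N. bounded_separation dist susp_shift n \<epsilon> K N
          \<and> real N \<le> real (M * card A ^ (2 * m + 1)) * real (card A) ^ n"
        using M(2)[OF \<open>n > 0\<close> K] by (intro exI[of _ ?N] conjI) simp_all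
    qed
  qed (use \<open>card A \<ge> 1\<close> in simp)
qed

lemma finite_set_uniformly_separated:
  fixes B :: "real set"
  assumes "finite B"
  obtains \<eta> where "\<eta> > 0" "\<And>a b. \<lbrakk>a \<in> B; b \<in> B; a \<noteq> b\<rbrakk> \<Longrightarrow> \<eta> \<le> \<bar>a - b\<bar>"
proof
  \<comment> \<open>The 1 keeps \<open>D\<close> nonempty if \<open>B\<close> has no two distinct
    elements.\<close>
  define D where "D = insert 1 ((\<lambda>(a, b). \<bar>a - b\<bar>) ` (B \<times> B - Id))"
  have D: "finite D" "D \<noteq> {}" using assms by (auto simp: D_def)
  then show "Min D > 0" by (subst Min_gr_iff) (auto simp: D_def)
  fix a b assume "a \<in> B" "b \<in> B" "a \<noteq> b"
  then have "\<bar>a - b\<bar> \<in> D" by (force simp: D_def)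
  then show "Min D \<le> \<bar>a - b\<bar>" using D(1) by simp
qed

text \<open>All words of length \<open>n\<close> over \<open>B\<close> are realised at time 1/2,
  where the bump equals 1: the \<open>j\<close>-th iterate shows the letter \<open>j\<close>
  unscaled in one coordinate, so different words become separated.\<close>

lemma htop_suspension_ge:
  assumes A: "compact A" "A \<subseteq> {0..1}" and B: "B \<subseteq> A" "finite B" "B \<noteq> {}"
  shows "ereal (ln (real (card B))) \<le> htop (suspension A) dist susp_shift"
proof -
  \<comment> \<open>The coordinate with offset 0, which samples the wave at the current
    time.\<close>
  define i where "i = Suc (Suc (int_encode 0))"
  obtain \<eta> where \<eta>: "\<eta> > 0" "\<And>a b. \<lbrakk>a \<in> B; b \<in> B; a \<noteq> b\<rbrakk> \<Longrightarrow> \<eta> \<le> \<bar>a - b\<bar>"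
    using finite_set_uniformly_separated[OF \<open>finite B\<close>] by blast
  obtain \<delta> where \<delta>: "\<delta> > 0" "\<And>x y :: point. dist x y < \<delta> \<Longrightarrow> \<bar>x i - y i\<bar> < \<eta>"
    using dist_point_coord[OF \<open>\<eta> > 0\<close>] by metis
  obtain b where "b \<in> B" using B by blast
  have read: "(susp_shift ^^ j) (susp (1/2) y) i = y (int j)" for j y
  proof -
    have "sin (pi * (1/2 + real j)) = cos (pi * of_int (int j))"
      by (simp add: distrib_left sin_add)
    then have "\<bar>sin (pi * (1/2 + real j))\<bar> = 1" by (simp only: cos_npi_int) simp
    moreover have "\<lfloor>1/2 + real j\<rfloor> = int j" by linarith
    ultimately show ?thesis by (simp add: susp_shift_power i_def wave_def)
  qed
  have "ereal (ln (real (card B))) \<le> htop_on dist susp_shift (suspension A)"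
  proof (rule htop_on_ge)
    show "\<exists>N. bounded_separation dist susp_shift n \<epsilon> (suspension A) N" if "n > 0" "\<epsilon> > 0" for n \<epsilon>
      using bounded_separation_suspension[OF A(2) \<open>\<epsilon> > 0\<close>] \<open>n > 0\<close> by (metis subset_refl)
    \<comment> \<open>Different words reach distance at least \<delta>, while separation is a strict
      inequality; hence the half.\<close>
    show "\<delta> / 2 > 0" "card B > 0" using \<open>\<delta> > 0\<close> B by (auto simp: card_gt_0_iff)
    fix n :: nat assume "n > 0"
    \<comment> \<open>Outside the positions of the word the sequence is padded with a fixed
      letter.\<close>
    define word where "word = (\<lambda>w l. if 0 \<le> l \<and> l < int n then w (nat l) else b)"
    define p where "p = (\<lambda>w. susp (1/2) (word w))"
    define P where "P = (\<Pi>\<^sub>E j\<in>{..<n}. B)"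
    have sep: "\<exists>j<n. dist ((susp_shift ^^ j) (p w)) ((susp_shift ^^ j) (p w')) > \<delta> / 2"
      if w: "w \<in> P" "w' \<in> P" "w \<noteq> w'" for w w'
    proof -
      obtain j where j: "j < n" "w j \<noteq> w' j"
        using w PiE_ext[of w "{..<n}" "\<lambda>_. B" w'] by (auto simp: P_def)
      then have "\<eta> \<le> \<bar>w j - w' j\<bar>" using w \<eta>(2) by (auto simp: P_def PiE_def Pi_def)
      also have "\<dots> = \<bar>(susp_shift ^^ j) (p w) i - (susp_shift ^^ j) (p w') i\<bar>"
        using j by (simp add: p_def read word_def)
      finally have "\<not> dist ((susp_shift ^^ j) (p w)) ((susp_shift ^^ j) (p w')) < \<delta>"
        using \<delta>(2) by (meson not_less)
      then show ?thesis using j \<open>\<delta> > 0\<close> by (intro exI[of _ j]) auto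
    qed
    show "\<exists>E\<subseteq>suspension A. finite E \<and> separated_set dist susp_shift n (\<delta> / 2) E
        \<and> card E = card B ^ n"
    proof (intro exI[of _ "p ` P"] conjI)
      have "range (word w) \<subseteq> A" if "w \<in> P" for w
        using that \<open>b \<in> B\<close> B(1) by (auto simp: word_def P_def PiE_def Pi_def)
      then show "p ` P \<subseteq> suspension A" by (auto simp: p_def intro: susp_in_suspension)
      show "finite (p ` P)" using B by (auto simp: P_def intro: finite_PiE)
      show "separated_set dist susp_shift n (\<delta> / 2) (p ` P)"
        using sep unfolding separated_set_def bowen_dist_gt_iff[OF \<open>n > 0\<close>] by blast
      have "inj_on p P"
      proof (rule inj_onI, rule ccontr)
        fix w w' assume "w \<in> P" "w' \<in> P" "p w = p w'" "w \<noteq> w'"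
        then show False using sep[of w w'] \<open>\<delta> > 0\<close> by auto
      qed
      then show "card (p ` P) = card B ^ n" by (simp add: card_image P_def card_PiE)
    qed
  qed
  also have "\<dots> \<le> htop (suspension A) dist susp_shift"
    unfolding htop_def mtopology_subset
    using compact_suspension[OF A] by (intro SUP_upper) (simp add: compactin_subtopology)
  finally show ?thesis .
qed

section \<open>Maps close to the identity\<close>

text \<open>Modulo \<open>2 * pi\<close> the angle lies between \<open>-pi\<close> and
  \<open>pi\<close>; a positive cosine puts it within \<open>pi / 2\<close> of 0, where
  \<open>arcsin\<close> inverts \<open>sin\<close>.\<close>

lemma arcsin_sin_cos_pos:
  assumes "cos w > 0"
  obtains m :: int where "w = arcsin (sin w) + 2 * pi * of_int m"
proof -
  define m where "m = \<lfloor>w / (2 * pi) + 1/2\<rfloor>"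
  define v where "v = w - 2 * pi * of_int m"
  have "of_int m \<le> w / (2 * pi) + 1/2" "w / (2 * pi) + 1/2 < of_int m + 1"
    unfolding m_def by linarith+
  then have "\<bar>v\<bar> \<le> pi" by (simp add: v_def field_simps abs_le_iff)
  have w: "w = v + 2 * pi * of_int m" by (simp add: v_def)
  have sc: "sin w = sin v" "cos w = cos v"
    unfolding w sin_add cos_add sin_int_2pin cos_int_2pin by simp_all
  have "\<bar>v\<bar> < pi / 2"
  proof (rule ccontr)
    assume "\<not> \<bar>v\<bar> < pi / 2"
    then have "cos \<bar>v\<bar> \<le> cos (pi / 2)"
      using \<open>\<bar>v\<bar> \<le> pi\<close> by (intro cos_monotone_0_pi_le) auto
    then show False using assms sc by simp
  qed
  then have "arcsin (sin v) = v" by (intro arcsin_sin) auto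
  then show ?thesis using that[of m] w sc by simp
qed

lemma sin_pi_nonzero:
  assumes "of_int n < u" "u < of_int n + 1"
  shows "sin (pi * u) \<noteq> 0"
proof
  assume "sin (pi * u) = 0"
  then obtain i :: int where "pi * u = of_int i * pi" by (auto simp: sin_zero_iff_int2)
  then have "u = of_int i" by simp
  with assms show False by simp
qed

text \<open>A continuous phase correction is computed from the two circle coordinates. The remaining
  sequence is then continuous along the flow line with letters in a countable set, hence constant.
  As the phase error stays bounded for all times, \<delta> does not depend on
  \<open>j\<close>.\<close>

lemma near_identity_shadows:
  assumes A: "countable A" "A \<subseteq> {0..1}" and "\<epsilon> > 0"
  obtains \<delta> where "\<delta> > 0"
    "\<And>h x j. \<lbrakk>continuous_on (suspension A) h; h ` suspension A \<subseteq> suspension A;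
        \<And>x. x \<in> suspension A \<Longrightarrow> dist (h x) x < \<delta>; x \<in> suspension A\<rbrakk>
      \<Longrightarrow> dist ((susp_shift ^^ j) (h x)) ((susp_shift ^^ j) x) \<le> \<epsilon>"
proof -
  obtain r where "r > 0" and r: "\<And>y t t'. \<lbrakk>range y \<subseteq> {0..1}; \<bar>t - t'\<bar> \<le> r\<rbrakk>
      \<Longrightarrow> dist (susp t y) (susp t' y) \<le> \<epsilon> / 2"
    using susp_time_uniform[of "\<epsilon> / 2"] \<open>\<epsilon> > 0\<close> by (metis half_gt_zero)
  have "isCont arcsin 0" by (rule isCont_arcsin) auto
  \<comment> \<open>After division by \<open>2 * pi\<close> the phase shift is at most
    \<open>r / 2\<close>, so two phase shifts differ by at most \<open>r\<close>.\<close>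
  then obtain \<rho> where "\<rho> > 0" and \<rho>: "\<And>u. \<bar>u\<bar> < \<rho> \<Longrightarrow> \<bar>arcsin u\<bar> < pi * r"
    unfolding continuous_at_eps_delta using \<open>r > 0\<close>
    by (metis mult_pos_pos pi_gt_zero arcsin_0 diff_zero dist_real_def)
  \<comment> \<open>\<open>2 * \<eta>\<close> bounds the sine of the phase difference, so it may not
    exceed \<rho>; the cosine exceeds \<open>1 - 2 * \<eta>\<close>, which the 1/2 keeps
    nonnegative.\<close>
  define \<eta> where "\<eta> = min (\<rho> / 2) (1/2)"
  have "\<eta> > 0" using \<open>\<rho> > 0\<close> by (simp add: \<eta>_def)
  obtain \<delta>0 where \<delta>0: "\<delta>0 > 0" "\<And>x y :: point. dist x y < \<delta>0 \<Longrightarrow> \<bar>x 0 - y 0\<bar> < \<eta>"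
    using dist_point_coord[OF \<open>\<eta> > 0\<close>, of 0] by metis
  obtain \<delta>1 where \<delta>1: "\<delta>1 > 0" "\<And>x y :: point. dist x y < \<delta>1 \<Longrightarrow> \<bar>x (Suc 0) - y (Suc 0)\<bar> < \<eta>"
    using dist_point_coord[OF \<open>\<eta> > 0\<close>, of "Suc 0"] by metis
  define \<delta> where "\<delta> = min (\<epsilon> / 2) (min \<delta>0 \<delta>1)"
  show ?thesis
  proof (rule that[of \<delta>])
    show "\<delta> > 0" using \<open>\<epsilon> > 0\<close> \<delta>0(1) \<delta>1(1) by (simp add: \<delta>_def)
    fix h x j
    assume cont: "continuous_on (suspension A) h" and maps: "h ` suspension A \<subseteq> suspension A"
      and near: "\<And>x. x \<in> suspension A \<Longrightarrow> dist (h x) x < \<delta>" and "x \<in> suspension A"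
    from \<open>x \<in> suspension A\<close> obtain a y where x: "x = susp a y" "range y \<subseteq> A"
      by (rule suspension_normal_form)
    define z where "z = (\<lambda>t. h (susp (a + t) y))"
    \<comment> \<open>The sine of the phase difference between \<open>z t\<close> and
      \<open>susp (a + t) y\<close>. Being written in coordinates, it is continuous whatever
      representation of \<open>z t\<close> is chosen.\<close>
    define D where "D = (\<lambda>t. z t (Suc 0) * cos (2 * pi * (a + t)) - z t 0 * sin (2 * pi * (a + t)))"
    define s where "s = (\<lambda>t. arcsin (D t) / (2 * pi))"
    have lift: "\<exists>Y. range Y \<subseteq> A \<and> z t = susp (a + t + s t) Y \<and> \<bar>s t\<bar> \<le> r / 2 \<and> \<bar>D t\<bar> \<le> 1" for t
    proof -
      let ?x = "susp (a + t) y"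
      have "?x \<in> suspension A" using x by (simp add: susp_in_suspension)
      \<comment> \<open>Chosen for each \<open>t\<close> separately, so nothing is known yet about
        continuity in \<open>t\<close>.\<close>
      then obtain b Y where Y: "z t = susp b Y" "range Y \<subseteq> A"
        using maps suspension_normal_form[of "z t" A] by (metis z_def image_subset_iff)
      define \<alpha> \<beta> where "\<alpha> = 2 * pi * (a + t)" and "\<beta> = 2 * pi * b"
      have "dist (z t) ?x < \<delta>" unfolding z_def using near \<open>?x \<in> suspension A\<close> .
      then have close: "\<bar>cos \<beta> - cos \<alpha>\<bar> < \<eta>" "\<bar>sin \<beta> - sin \<alpha>\<bar> < \<eta>"
        using \<delta>0(2)[of "z t" ?x] \<delta>1(2)[of "z t" ?x] Y by (auto simp: \<delta>_def \<alpha>_def \<beta>_def)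
      have D: "D t = sin (\<beta> - \<alpha>)"
        using Y by (simp add: D_def sin_diff \<alpha>_def \<beta>_def mult.commute)
      have small: "\<bar>(cos \<beta> - cos \<alpha>) * u\<bar> < \<eta>" "\<bar>(sin \<beta> - sin \<alpha>) * u\<bar> < \<eta>" if "\<bar>u\<bar> \<le> 1" for u
      proof -
        have "\<bar>v * u\<bar> \<le> \<bar>v\<bar>" for v
          using mult_left_mono[OF that, of "\<bar>v\<bar>"] by (simp add: abs_mult)
        then show "\<bar>(cos \<beta> - cos \<alpha>) * u\<bar> < \<eta>" "\<bar>(sin \<beta> - sin \<alpha>) * u\<bar> < \<eta>"
          using close le_less_trans by blast+
      qed
      have "sin (\<beta> - \<alpha>) = (sin \<beta> - sin \<alpha>) * cos \<alpha> - (cos \<beta> - cos \<alpha>) * sin \<alpha>"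
        by (simp add: sin_diff algebra_simps)
      then have "\<bar>D t\<bar> < 2 * \<eta>"
        using small(1)[of "sin \<alpha>"] small(2)[of "cos \<alpha>"] D by simp
      also have "\<dots> \<le> \<rho>" by (simp add: \<eta>_def)
      finally have "\<bar>arcsin (D t)\<bar> < pi * r" by (rule \<rho>)
      then have s: "\<bar>s t\<bar> \<le> r / 2" by (simp add: s_def field_simps)
      have "cos (\<beta> - \<alpha>) = (cos \<alpha>)\<^sup>2 + (sin \<alpha>)\<^sup>2 + (cos \<beta> - cos \<alpha>) * cos \<alpha> + (sin \<beta> - sin \<alpha>) * sin \<alpha>"
        by (simp add: cos_diff algebra_simps power2_eq_square)
      then have "cos (\<beta> - \<alpha>) > 1 - 2 * \<eta>"
        using small(1)[of "cos \<alpha>"] small(2)[of "sin \<alpha>"] by simp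
      moreover have "2 * \<eta> \<le> 1" by (simp add: \<eta>_def)
      ultimately have "cos (\<beta> - \<alpha>) > 0" by linarith
      \<comment> \<open>The phase \<open>b\<close> agrees with \<open>a + t + s t\<close> up to an
        integer, which is then absorbed into the sequence.\<close>
      then obtain m where "\<beta> - \<alpha> = arcsin (sin (\<beta> - \<alpha>)) + 2 * pi * of_int m"
        by (rule arcsin_sin_cos_pos)
      then have "\<beta> = \<alpha> + arcsin (D t) + 2 * pi * of_int m" unfolding D by linarith
      then have "2 * pi * b = 2 * pi * (a + t + s t + of_int m)"
        by (simp add: s_def \<alpha>_def \<beta>_def algebra_simps)
      then have "b = a + t + s t + of_int m" by simp
      then have "z t = susp (a + t + s t) (\<lambda>n. Y (n + m))" by (simp add: Y susp_add_int)
      then show ?thesis using s Y(2) D by (intro exI[of _ "\<lambda>n. Y (n + m)"]) auto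
    qed
    then obtain Y where Y: "\<And>t. range (Y t) \<subseteq> A" "\<And>t. z t = susp (a + t + s t) (Y t)"
      and s: "\<And>t. \<bar>s t\<bar> \<le> r / 2" and D: "\<And>t. \<bar>D t\<bar> \<le> 1" by metis
    have "continuous_on UNIV (\<lambda>t. susp (fst (a + t, y)) (snd (a + t, y)))"
      using x A by (intro continuous_on_compose2[OF continuous_on_susp] continuous_intros) auto
    then have "continuous_on UNIV (\<lambda>t. susp (a + t) y)" by simp
    then have "continuous_on UNIV z"
      unfolding z_def by (rule continuous_on_compose2[OF cont]) (auto simp: x susp_in_suspension)
    then have z: "continuous_on UNIV (\<lambda>t. z t i)" for i
      by (rule continuous_on_product_then_coordinatewise)
    have "continuous_on UNIV D" unfolding D_def by (intro continuous_intros z)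
    then have "continuous_on UNIV s"
      unfolding s_def using D by (intro continuous_intros) (auto simp: abs_le_iff)
    then have b: "continuous_on UNIV (\<lambda>t. a + t + s t)" by (intro continuous_intros)
    \<comment> \<open>Near \<open>t0\<close> the letter is a coordinate of \<open>z t\<close>
      divided by a nonvanishing sine.\<close>
    have "continuous_on UNIV (\<lambda>t. Y t n)" for n
      unfolding continuous_on_eq_continuous_at[OF open_UNIV]
    proof
      fix t0
      \<comment> \<open>From \<open>c < k \<le> c + 1\<close> the sample point \<open>f t0\<close>
        lies above \<open>n\<close> and at most at \<open>n + 1/2\<close>, strictly inside the unit
        interval of the letter \<open>n\<close>. This uses the half-integer offsets.\<close>
      define c where "c = 2 * of_int n - 2 * (a + t0 + s t0)"
      define k where "k = \<lfloor>c\<rfloor> + 1"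
      define f where "f = (\<lambda>t. a + t + s t + of_int k / 2)"
      have f: "continuous_on UNIV f" unfolding f_def by (intro continuous_intros b)
      have "c < of_int k" "of_int k \<le> c + 1" unfolding k_def by linarith+
      then have "of_int n < f t0" and "f t0 < of_int n + 1" by (auto simp: f_def c_def field_simps)
      moreover have "(f \<longlongrightarrow> f t0) (nhds t0)"
        using f by (simp add: continuous_on_eq_continuous_at isCont_def tendsto_at_iff_tendsto_nhds)
      ultimately have "\<forall>\<^sub>F t in nhds t0. of_int n < f t" "\<forall>\<^sub>F t in nhds t0. f t < of_int n + 1"
        by (auto dest: order_tendstoD)
      then have ev: "\<forall>\<^sub>F t in nhds t0. z t (Suc (Suc (int_encode k))) / \<bar>sin (pi * f t)\<bar> = Y t n"
      proof eventually_elim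
        case (elim t)
        then have fl: "\<lfloor>f t\<rfloor> = n" by linarith
        have "sin (pi * f t) \<noteq> 0" using elim by (rule sin_pi_nonzero)
        then show ?case using fl by (simp add: Y(2) wave_def f_def add.assoc)
      qed
      have nz: "sin (pi * f t0) \<noteq> 0"
        using \<open>of_int n < f t0\<close> \<open>f t0 < of_int n + 1\<close> by (rule sin_pi_nonzero)
      have "isCont (\<lambda>t. z t (Suc (Suc (int_encode k))) / \<bar>sin (pi * f t)\<bar>) t0"
        using z f nz by (intro continuous_intros) (auto simp: continuous_on_eq_continuous_at)
      then show "isCont (\<lambda>t. Y t n) t0" using isCont_cong[OF ev] by blast
    qed
    \<comment> \<open>A connected set of reals with two different points is uncountable, so each
      letter is constant in \<open>t\<close>.\<close>
    then have "connected (range (\<lambda>t. Y t n))" for n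
      by (intro connected_continuous_image) auto
    moreover have "countable (range (\<lambda>t. Y t n))" for n
      by (rule countable_subset[OF _ A(1)]) (use Y(1) in blast)
    ultimately have const: "Y t = Y 0" for t
      using connected_uncountable by (metis ext rangeI)
    \<comment> \<open>The iterate of \<open>h x\<close> and the image under \<open>h\<close> of the
      iterate of \<open>x\<close> carry the same sequence \<open>Y 0\<close>; their times differ by
      \<open>s 0 - s (real j)\<close>.\<close>
    have "\<bar>(a + 0 + s 0 + real j) - (a + real j + s (real j))\<bar> \<le> r"
      using s[of 0] s[of "real j"] by linarith
    then have "dist (susp (a + 0 + s 0 + real j) (Y 0)) (susp (a + real j + s (real j)) (Y 0)) \<le> \<epsilon> / 2"
      using Y(1)[of 0] A(2) by (intro r) auto
    moreover have "(susp_shift ^^ j) (h x) = susp (a + 0 + s 0 + real j) (Y 0)"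
      using Y(2)[of 0] by (simp add: z_def x susp_shift_power)
    moreover have "susp (a + real j + s (real j)) (Y 0) = h ((susp_shift ^^ j) x)"
      using Y(2)[of "real j"] const[of "real j"] by (simp add: z_def x susp_shift_power)
    moreover have "dist (h ((susp_shift ^^ j) x)) ((susp_shift ^^ j) x) < \<delta>"
      by (rule near) (simp add: x susp_shift_power susp_in_suspension)
    moreover have "\<delta> \<le> \<epsilon> / 2" by (simp add: \<delta>_def)
    ultimately show "dist ((susp_shift ^^ j) (h x)) ((susp_shift ^^ j) x) \<le> \<epsilon>"
      using dist_triangle[of "(susp_shift ^^ j) (h x)" "(susp_shift ^^ j) x" "h ((susp_shift ^^ j) x)"]
      by simp
  qed
qed

section \<open>The functional envelope\<close>

text \<open>\<open>fdist\<close> is a metric on \<open>fspace\<close>, the extensional maps into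
  \<open>X\<close> with bounded image; compactness provides the boundedness.\<close>

lemma homeo_group_subset_fspace:
  fixes X :: "'a::metric_space set"
  assumes "compact X"
  shows "homeo_group X dist \<subseteq> Metric_space.fspace X dist X"
proof -
  interpret Metric_space X dist by (rule Metric_space_subset)
  have "mbounded X"
    using assms by (intro compactin_imp_mbounded) (simp add: mtopology_subset compactin_subtopology)
  then show ?thesis
    by (auto simp: homeo_group_def homeomorphism_of_def mtopology_subset fspace_def
        homeomorphic_eq_everything_map intro: mbounded_subset)
qed

lemma dist_le_uniform_dist:
  fixes X :: "'a::metric_space set"
  assumes "compact X" "\<phi> \<in> homeo_group X dist" "\<psi> \<in> homeo_group X dist" "x \<in> X"
  shows "dist (\<phi> x) (\<psi> x) \<le> uniform_dist X dist \<phi> \<psi>"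
proof -
  interpret Metric_space X dist by (rule Metric_space_subset)
  have fs: "\<phi> \<in> fspace X" "\<psi> \<in> fspace X"
    using homeo_group_subset_fspace[OF \<open>compact X\<close>] assms by blast+
  moreover have "dist (\<phi> x) (\<psi> x) \<le> (SUP x\<in>X. dist (\<phi> x) (\<psi> x))"
    using \<open>x \<in> X\<close> by (intro cSUP_upper bdd_above_dist fs) auto
  ultimately show ?thesis using \<open>x \<in> X\<close> by (auto simp: uniform_dist_def fdist_def)
qed

text \<open>\<open>fdist\<close> has the default value 0 outside \<open>fspace\<close> and for empty
  \<open>X\<close>; there the bound comes from \<open>\<epsilon> \<ge> 0\<close>.\<close>

lemma uniform_dist_le:
  fixes X :: "'a::metric_space set"
  assumes "\<epsilon> \<ge> 0" "\<And>x. x \<in> X \<Longrightarrow> dist (\<phi> x) (\<psi> x) \<le> \<epsilon>"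
  shows "uniform_dist X dist \<phi> \<psi> \<le> \<epsilon>"
  unfolding uniform_dist_def Metric_space.fdist_def[OF Metric_space_subset]
  using assms by (auto intro: cSUP_least)

lemma envelope_map_power:
  "x \<in> X \<Longrightarrow> (envelope_map X T ^^ j) \<phi> x = (T ^^ j) (\<phi> x)"
  by (induction j) (simp_all add: envelope_map_def compose_eq)

lemma homeo_group_inverse:
  fixes X :: "'a::metric_space set"
  assumes "\<phi> \<in> homeo_group X dist"
  obtains g where "continuous_on X \<phi>" "\<phi> ` X \<subseteq> X" "continuous_on X g" "g ` X \<subseteq> X"
    "\<And>x. x \<in> X \<Longrightarrow> g (\<phi> x) = x" "\<And>x. x \<in> X \<Longrightarrow> \<phi> (g x) = x"
proof -
  obtain g where "homeomorphic_maps (top_of_set X) (top_of_set X) \<phi> g"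
    using assms
    by (auto simp: homeo_group_def homeomorphism_of_def mtopology_subset homeomorphic_map_maps)
  then show ?thesis
    using that by (auto simp: homeomorphic_maps_def image_subset_iff_funcset)
qed

lemma htop_envelope_suspension:
  assumes A: "compact A" "countable A" "A \<subseteq> {0..1}"
  shows "htop_envelope (suspension A) dist susp_shift = 0"
  unfolding htop_envelope_def
proof (rule htop_equicontinuous)
  let ?X = "suspension A"
  let ?H = "homeo_group ?X dist"
  have X: "compact ?X" using A by (intro compact_suspension)
  show "Metric_space ?H (uniform_dist ?X dist)"
    unfolding uniform_dist_def
    by (intro Metric_space.subspace[OF Metric_space.Metric_space_funspace[OF Metric_space_subset]]
        homeo_group_subset_fspace X)
  fix \<epsilon> :: real assume "\<epsilon> > 0"
  obtain \<delta> where "\<delta> > 0" and \<delta>: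
    "\<And>h x j. \<lbrakk>continuous_on ?X h; h ` ?X \<subseteq> ?X; \<And>x. x \<in> ?X \<Longrightarrow> dist (h x) x < \<delta>; x \<in> ?X\<rbrakk>
      \<Longrightarrow> dist ((susp_shift ^^ j) (h x)) ((susp_shift ^^ j) x) \<le> \<epsilon>"
    using near_identity_shadows[OF A(2,3) \<open>\<epsilon> > 0\<close>] by metis
  have "uniform_dist ?X dist ((envelope_map ?X susp_shift ^^ j) \<phi>) ((envelope_map ?X susp_shift ^^ j) \<psi>) \<le> \<epsilon>"
    if H: "\<phi> \<in> ?H" "\<psi> \<in> ?H" and close: "uniform_dist ?X dist \<phi> \<psi> < \<delta>" for \<phi> \<psi> j
  proof (rule uniform_dist_le)
    obtain g where g: "continuous_on ?X g" "g ` ?X \<subseteq> ?X"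
      "\<And>x. x \<in> ?X \<Longrightarrow> g (\<psi> x) = x" "\<And>x. x \<in> ?X \<Longrightarrow> \<psi> (g x) = x" and "\<psi> ` ?X \<subseteq> ?X"
      using homeo_group_inverse[OF H(2)] by metis
    have \<phi>: "continuous_on ?X \<phi>" "\<phi> ` ?X \<subseteq> ?X" using homeo_group_inverse[OF H(1)] by metis+
    fix x assume "x \<in> ?X"
    \<comment> \<open>With \<open>g\<close> inverse to \<psi>, the map
      \<open>\<phi> \<circ> g\<close> is close to the identity and sends \<open>\<psi> x\<close> to
      \<open>\<phi> x\<close>, so shadowing at \<open>\<psi> x\<close> compares the two
      orbits.\<close>
    have "dist ((susp_shift ^^ j) ((\<phi> \<circ> g) (\<psi> x))) ((susp_shift ^^ j) (\<psi> x)) \<le> \<epsilon>"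
    proof (rule \<delta>)
      show "continuous_on ?X (\<phi> \<circ> g)" using g \<phi> by (intro continuous_on_compose) (auto intro: continuous_on_subset)
      show "(\<phi> \<circ> g) ` ?X \<subseteq> ?X" using g(2) \<phi>(2) by auto
      show "\<psi> x \<in> ?X" using \<open>\<psi> ` ?X \<subseteq> ?X\<close> \<open>x \<in> ?X\<close> by blast
      fix u assume "u \<in> ?X"
      then have "g u \<in> ?X" "\<psi> (g u) = u" using g by auto
      then show "dist ((\<phi> \<circ> g) u) u < \<delta>"
        using dist_le_uniform_dist[OF X H, of "g u"] close by simp
    qed
    then show "dist ((envelope_map ?X susp_shift ^^ j) \<phi> x) ((envelope_map ?X susp_shift ^^ j) \<psi> x) \<le> \<epsilon>"
      using \<open>x \<in> ?X\<close> g(3) by (simp add: envelope_map_power)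
  qed (use \<open>\<epsilon> > 0\<close> in simp)
  then show "\<exists>\<delta>>0. \<forall>\<phi>\<in>?H. \<forall>\<psi>\<in>?H. uniform_dist ?X dist \<phi> \<psi> < \<delta> \<longrightarrow>
      (\<forall>j. uniform_dist ?X dist ((envelope_map ?X susp_shift ^^ j) \<phi>)
        ((envelope_map ?X susp_shift ^^ j) \<psi>) \<le> \<epsilon>)"
    using \<open>\<delta> > 0\<close> by blast
qed

section \<open>The two alphabets\<close>

lemma htop_suspension_infinite:
  assumes A: "compact A" "A \<subseteq> {0..1}" "infinite A"
  shows "htop (suspension A) dist susp_shift = \<infinity>"
proof (rule ereal_top)
  fix b :: real
  obtain k where k: "exp b \<le> real k" using real_arch_simple by blast
  \<comment> \<open>Finite subalphabets of \<open>A\<close> can be arbitrarily large, and each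
    contributes the logarithm of its size.\<close>
  obtain B where B: "finite B" "card B = Suc k" "B \<subseteq> A"
    using infinite_arbitrarily_large[OF \<open>infinite A\<close>] by blast
  have "exp b \<le> real (card B)" using k B(2) by simp
  then have "b \<le> ln (real (card B))" using B(2) by (simp add: ln_ge_iff)
  moreover have "ereal (ln (real (card B))) \<le> htop (suspension A) dist susp_shift"
    using B by (intro htop_suspension_ge[OF A(1,2)]) auto
  ultimately show "ereal b \<le> htop (suspension A) dist susp_shift"
    by (metis ereal_less_eq(3) order_trans)
qed

theorem corollary2:
  shows "(\<exists>(X :: point set) d T. compact_metric X d \<and> homeomorphism_of X d T \<and>
            0 < htop X d T \<and> htop X d T < \<infinity> \<and> htop_envelope X d T = 0) \<and>
         (\<exists>(X :: point set) d T. compact_metric X d \<and> homeomorphism_of X d T \<and>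
            htop X d T = \<infinity> \<and> htop_envelope X d T = 0)"
proof (intro conjI exI)
  \<comment> \<open>Two letters: both entropy bounds equal \<open>ln 2\<close>.\<close>
  let ?A = "{0, 1 :: real}"
  have A: "compact ?A" "countable ?A" "?A \<subseteq> {0..1}" by (auto intro: finite_imp_compact)
  show "compact_metric (suspension ?A) dist" "homeomorphism_of (suspension ?A) dist susp_shift"
    "htop_envelope (suspension ?A) dist susp_shift = 0"
    using A by (auto intro: compact_metric_suspension homeomorphism_susp_shift htop_envelope_suspension)
  have "0 < ereal (ln (real (card ?A)))" by simp
  also have "\<dots> \<le> htop (suspension ?A) dist susp_shift" using A by (intro htop_suspension_ge) auto
  finally show "0 < htop (suspension ?A) dist susp_shift" .
  have "htop (suspension ?A) dist susp_shift \<le> ereal (ln (real (card ?A)))"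
    using A by (intro htop_suspension_le) auto
  then show "htop (suspension ?A) dist susp_shift < \<infinity>" by (rule le_less_trans) simp
next
  \<comment> \<open>A convergent sequence with its limit: infinite for infinite entropy, yet compact
    and countable as the envelope argument requires.\<close>
  let ?A = "insert 0 (range (\<lambda>n. inverse (real (Suc n))))"
  have A: "compact ?A" by (rule compact_sequence_with_limit[OF LIMSEQ_inverse_real_of_nat])
  have "countable ?A" by simp
  have A01: "?A \<subseteq> {0..1}" by (auto simp: field_simps)
  have "infinite ?A" by (auto simp: finite_image_iff inj_on_def)
  show "compact_metric (suspension ?A) dist" by (rule compact_metric_suspension[OF A A01])
  show "homeomorphism_of (suspension ?A) dist susp_shift" by (rule homeomorphism_susp_shift)
  show "htop (suspension ?A) dist susp_shift = \<infinity>"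
    by (rule htop_suspension_infinite[OF A A01 \<open>infinite ?A\<close>])
  show "htop_envelope (suspension ?A) dist susp_shift = 0"
    by (rule htop_envelope_suspension[OF A \<open>countable ?A\<close> A01])
qed

end
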